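(* Let $\mathcal{B}$ be a boolean $\mathcal{C}$-algebra. If $\mathcal{B}$ is consistently Noetherian, then $\mathcal{B}$ is equationally Noetherian.
   Context: Language. Let $\mathcal{L}=\{\vee,\cdot,\bar{\ },0,1\}\cup\{\mathbf{c}_i\mid i\in I\}$ be the language of boolean algebras (disjunction, conjunction, negation, $0$, $1$) extended by an arbitrary (possibly infinite) set of constant symbols. A boolean $\mathcal{C}$-algebra is a boolean algebra $\mathcal{B}$ regarded as a structure of the language $\mathcal{L}$, where $\mathcal{C}\subseteq\mathcal{B}$ denotes the boolean subalgebra generated by (the interpretations of) the constants $\mathbf{c}_i$, $i\in I$. Equations. For a finite set of variables $X=\{x_1,\dots,x_n\}$, an equation over $\mathcal{B}$ is an atomic formula $\tau(X)=\sigma(X)$, where $\tau,\sigma$ are $\mathcal{L}$-terms in $X$. A system is an arbitrary (possibly infinite) set of equations in a common finite set of variables. A system is inconsistent over $\mathcal{B}$ if it has no solution in $\mathcal{B}^n$, and consistent otherwise. Two systems in variables $X$ are equivalent over $\mathcal{B}$ if they have the same solution set in $\mathcal{B}^n$. Noetherian properties. $\mathcal{B}$ is equationally Noetherian if for any system $\mathcal{S}$ (consistent or not) there exists a finite subsystem $\mathcal{S}'\subseteq\mathcal{S}$ equivalent to $\mathcal{S}$ over $\mathcal{B}$. $\mathcal{B}$ is consistently Noetherian if for any system $\mathcal{S}$ which is consistent over $\mathcal{B}$ there exists a finite subsystem $\mathcal{S}'\subseteq\mathcal{S}$ equivalent to $\mathcal{S}$ over $\mathcal{B}$. *)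

theory Defs
  imports Main "HOL-Library.FuncSet"
begin

text \<open>
  A boolean \<open>\<C>\<close>-algebra is a type \<open>'b\<close> of class \<^class>\<open>boolean_algebra\<close> together with an index set
  \<open>I\<close> (possibly empty or infinite) and an interpretation \<open>c\<close> of the constant symbols, of which
  only the values on \<open>I\<close> matter. The variables are \<open>x\<^sub>0, \<dots>, x\<^sub>n\<^sub>-\<^sub>1\<close>, and
  \<open>{..<n} \<rightarrow>\<^sub>E UNIV\<close> plays the role of \<open>\<B>\<^sup>n\<close>.
\<close>

datatype (bconsts: 'i, bvars: 'v) bterm =
    Var 'v
  | Const 'i
  | Zero
  | One
  | Join "('i, 'v) bterm" "('i, 'v) bterm"
  | Meet "('i, 'v) bterm" "('i, 'v) bterm"
  | Compl "('i, 'v) bterm"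

primrec bval :: "('i \<Rightarrow> 'b::boolean_algebra) \<Rightarrow> ('v \<Rightarrow> 'b) \<Rightarrow> ('i, 'v) bterm \<Rightarrow> 'b" where
  "bval c p (Var v) = p v"
| "bval c p (Const i) = c i"
| "bval c p Zero = bot"
| "bval c p One = top"
| "bval c p (Join s t) = sup (bval c p s) (bval c p t)"
| "bval c p (Meet s t) = inf (bval c p s) (bval c p t)"
| "bval c p (Compl t) = - bval c p t"

definition terms_in :: "'i set \<Rightarrow> nat \<Rightarrow> ('i, nat) bterm set" where
  "terms_in I n = {t. bconsts t \<subseteq> I \<and> bvars t \<subseteq> {..<n}}"

text \<open>The pair \<open>(\<tau>, \<sigma>)\<close> stands for the equation \<open>\<tau> = \<sigma>\<close>.\<close>

type_synonym 'i equation = "('i, nat) bterm \<times> ('i, nat) bterm"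

definition system_in :: "'i set \<Rightarrow> nat \<Rightarrow> 'i equation set \<Rightarrow> bool" where
  "system_in I n S \<longleftrightarrow> S \<subseteq> terms_in I n \<times> terms_in I n"

definition solutions :: "('i \<Rightarrow> 'b::boolean_algebra) \<Rightarrow> nat \<Rightarrow> 'i equation set \<Rightarrow> (nat \<Rightarrow> 'b) set" where
  "solutions c n S = {p \<in> {..<n} \<rightarrow>\<^sub>E UNIV. \<forall>(\<tau>, \<sigma>)\<in>S. bval c p \<tau> = bval c p \<sigma>}"

definition consistent :: "('i \<Rightarrow> 'b::boolean_algebra) \<Rightarrow> nat \<Rightarrow> 'i equation set \<Rightarrow> bool" where
  "consistent c n S \<longleftrightarrow> solutions c n S \<noteq> {}"

definition equivalent :: "('i \<Rightarrow> 'b::boolean_algebra) \<Rightarrow> nat \<Rightarrow> 'i equation set \<Rightarrow> 'i equation set \<Rightarrow> bool" where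
  "equivalent c n S T \<longleftrightarrow> solutions c n S = solutions c n T"

definition equationally_noetherian :: "'i set \<Rightarrow> ('i \<Rightarrow> 'b::boolean_algebra) \<Rightarrow> bool" where
  "equationally_noetherian I c \<longleftrightarrow>
     (\<forall>n S. system_in I n S \<longrightarrow> (\<exists>S'\<subseteq>S. finite S' \<and> equivalent c n S' S))"

definition consistently_noetherian :: "'i set \<Rightarrow> ('i \<Rightarrow> 'b::boolean_algebra) \<Rightarrow> bool" where
  "consistently_noetherian I c \<longleftrightarrow>
     (\<forall>n S. system_in I n S \<and> consistent c n S \<longrightarrow> (\<exists>S'\<subseteq>S. finite S' \<and> equivalent c n S' S))"

end

theory Submission imports Defs begin

text \<open>
  Multiply both sides of every equation of a system by a fresh variable \<open>y\<close>. The resulting system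
  is consistent, because \<open>y = 0\<close> solves it, so it is equivalent to a finite subsystem; setting
  \<open>y = 1\<close> gives back the original equations and turns this into a finite subsystem of the
  original system.
\<close>

definition guard :: "'v \<Rightarrow> ('i, 'v) bterm \<times> ('i, 'v) bterm \<Rightarrow> ('i, 'v) bterm \<times> ('i, 'v) bterm" where
  "guard y = map_prod (\<lambda>t. Meet t (Var y)) (\<lambda>t. Meet t (Var y))"

lemma bval_cong:
  "(\<And>v. v \<in> bvars t \<Longrightarrow> p v = q v) \<Longrightarrow> bval c p t = bval c q t"
  by (induction t) auto

lemma system_in_guard:
  assumes "system_in I n S"
  shows "system_in I (Suc n) (guard n ` S)"
  unfolding system_in_def
proof (rule image_subsetI)
  fix e
  assume "e \<in> S"
  then have "e \<in> terms_in I n \<times> terms_in I n"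
    using assms unfolding system_in_def by blast
  then show "guard n e \<in> terms_in I (Suc n) \<times> terms_in I (Suc n)"
    \<comment> \<open>The old variables lie below \<open>n\<close>, so \<open>n\<close> itself is
      fresh; \<open>less_Suc_eq\<close> admits it as the one extra variable.\<close>
    by (cases e) (simp add: terms_in_def guard_def subset_eq less_Suc_eq)
qed

lemma consistent_guard:
  fixes c :: "'i \<Rightarrow> 'b::boolean_algebra"
  shows "consistent c (Suc n) (guard n ` S)"
proof -
  \<comment> \<open>Only the value \<open>bot\<close> at \<open>n\<close> matters: it makes both
    sides of each guarded equation \<open>bot\<close>. The other coordinates are arbitrary.\<close>
  have "(\<lambda>i\<in>{..<Suc n}. bot) \<in> solutions c (Suc n) (guard n ` S)"
    by (auto simp: solutions_def guard_def)
  then show ?thesis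
    unfolding consistent_def by blast
qed

text \<open>The map sending \<open>p\<close> to \<open>p(n := top)\<close> embeds the n-th power of
  the algebra as the slice y = 1, where meeting with y changes nothing.\<close>

lemma solutions_guard_iff:
  assumes S: "system_in I n S" and p: "p \<in> {..<n} \<rightarrow>\<^sub>E UNIV"
  shows "p(n := top) \<in> solutions c (Suc n) (guard n ` S) \<longleftrightarrow> p \<in> solutions c n S"
proof -
  have ext: "p(n := top) \<in> {..<Suc n} \<rightarrow>\<^sub>E UNIV"
    using p by (auto simp: PiE_def extensional_def)
  \<comment> \<open>Overwriting \<open>p\<close> at \<open>n\<close> is harmless because
    \<open>n\<close> occurs in no term of \<open>S\<close>.\<close>
  have val: "bval c (p(n := top)) (fst e) = bval c p (fst e)"
            "bval c (p(n := top)) (snd e) = bval c p (snd e)" if "e \<in> S" for e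
  proof -
    have "e \<in> terms_in I n \<times> terms_in I n"
      using S that unfolding system_in_def by blast
    then have "n \<notin> bvars (fst e)" "n \<notin> bvars (snd e)"
      by (auto simp: terms_in_def)
    then show "bval c (p(n := top)) (fst e) = bval c p (fst e)"
      "bval c (p(n := top)) (snd e) = bval c p (snd e)"
      by (metis bval_cong fun_upd_other)+
  qed
  have "(\<forall>(\<tau>, \<sigma>)\<in>guard n ` S. bval c (p(n := top)) \<tau> = bval c (p(n := top)) \<sigma>) \<longleftrightarrow>
        (\<forall>(\<tau>, \<sigma>)\<in>S. bval c p \<tau> = bval c p \<sigma>)"
    unfolding ball_simps
    by (rule ball_cong) (simp_all add: guard_def split_beta val)
  then show ?thesis
    using ext p by (simp add: solutions_def)
qed

theorem theorem4p2:
  fixes I :: "'i set" and c :: "'i \<Rightarrow> 'b::boolean_algebra"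
  assumes "consistently_noetherian I c"
  shows "equationally_noetherian I c"
  unfolding equationally_noetherian_def
proof (intro allI impI)
  fix n S
  assume S: "system_in I n S"
  obtain T where T: "T \<subseteq> guard n ` S" "finite T" "equivalent c (Suc n) T (guard n ` S)"
    using assms system_in_guard[OF S] consistent_guard[of c n S]
    unfolding consistently_noetherian_def by metis
  \<comment> \<open>Choosing one preimage in \<open>S\<close> for each equation of \<open>T\<close>
    pulls the finite subsystem back.\<close>
  obtain S' where S': "S' \<subseteq> S" "finite S'" "T = guard n ` S'"
    using finite_subset_image[OF T(2,1)] by metis
  have sys': "system_in I n S'"
    using S S'(1) unfolding system_in_def by (rule order_trans[rotated])
  \<comment> \<open>Both memberships are tested at the same point \<open>p(n := top)\<close>, where
    \<open>T(3)\<close> identifies the two guarded systems.\<close>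
  have "p \<in> solutions c n S' \<longleftrightarrow> p \<in> solutions c n S" if "p \<in> {..<n} \<rightarrow>\<^sub>E UNIV" for p
    using solutions_guard_iff[OF S that, of c] solutions_guard_iff[OF sys' that, of c] T(3)
    unfolding S'(3) equivalent_def by simp
  moreover have "solutions c n U \<subseteq> {..<n} \<rightarrow>\<^sub>E UNIV" for U
    unfolding solutions_def by blast
  ultimately have "equivalent c n S' S"
    unfolding equivalent_def by (meson subset_antisym subset_iff)
  then show "\<exists>S'\<subseteq>S. finite S' \<and> equivalent c n S' S"
    using S'(1,2) by metis
qed

end
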